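(* Let $\pi/2\leq\delta<\pi$ and let $f\in\mathcal{A}$ belong to the class $\mathcal{M}(\delta)$. Then the logarithmic coefficients $\gamma_n$ of $f$ satisfy $$\sum_{n=1}^{\infty}|\gamma_n|^2\leq\frac{1}{16\sin^2\delta}\left[\frac{\pi^4}{45}-Li_4\left(e^{-2i\delta}\right)-Li_4\left(e^{2i\delta}\right)\right].$$ The result is sharp, i.e. for every such $\delta$ there is a function $f\in\mathcal{M}(\delta)$ for which equality holds.
   Context: $\Delta=\{z\in\mathbb{C}:|z|<1\}$ is the open unit disc. $\mathcal{A}$ is the class of functions $f$ analytic in $\Delta$ with $f(0)=0$ and $f'(0)=1$. For $\pi/2\le\delta<\pi$, $\mathcal{M}(\delta)$ is the class of all $f\in\mathcal{A}$ such that $$1+\frac{\delta-\pi}{2\sin\delta}<\mathrm{Re}\left\{\frac{zf'(z)}{f(z)}\right\}<1+\frac{\delta}{2\sin\delta}\quad(z\in\Delta).$$ Here $zf'(z)/f(z)$ is analytic in $\Delta$ with value $1$ at $z=0$; in particular $f(z)\neq0$ for $z\in\Delta\setminus\{0\}$. The logarithmic coefficients $\gamma_n=\gamma_n(f)$ ($n\ge1$) of such an $f$ are defined by $$\log\left\{\frac{f(z)}{z}\right\}=\sum_{n=1}^{\infty}2\gamma_n z^n\quad(z\in\Delta),$$ where $f(z)/z$ has value $1$ at $z=0$ and $\log\{f(z)/z\}$ is its analytic logarithm on $\Delta$ vanishing at $z=0$. For $|z|\le1$, $$Li_4(z)=\sum_{n=1}^{\infty}\frac{z^n}{n^4}=-\frac{1}{2}\int_{0}^{1}\frac{\log^2(1/t)\log(1-tz)}{t}\,{\rm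 d}t.$$ *)

theory Defs
  imports "HOL-Complex_Analysis.Complex_Analysis"
begin

definition class_A :: "(complex \<Rightarrow> complex) set" where
  "class_A = {f. f holomorphic_on ball 0 1 \<and> f 0 = 0 \<and> deriv f 0 = 1}"

text \<open>The functions \<open>z f'(z) / f(z)\<close> and \<open>f(z) / z\<close>, with the removable singularity at
  the origin filled in (the value is \<open>1\<close> for \<open>f\<close> in \<open>class_A\<close>).\<close>

definition log_deriv_quot :: "(complex \<Rightarrow> complex) \<Rightarrow> complex \<Rightarrow> complex" where
  "log_deriv_quot f z = (if z = 0 then 1 else z * deriv f z / f z)"

definition z_quot :: "(complex \<Rightarrow> complex) \<Rightarrow> complex \<Rightarrow> complex" where
  "z_quot f z = (if z = 0 then 1 else f z / z)"

text \<open>The condition \<open>f z \<noteq> 0\<close> makes explicit that \<open>z f'(z) / f(z)\<close> is analytic in the disc;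
  it must not be left to the convention \<open>x / 0 = 0\<close>.\<close>

definition class_M :: "real \<Rightarrow> (complex \<Rightarrow> complex) set" where
  "class_M \<delta> = {f \<in> class_A.
     (\<forall>z\<in>ball 0 1 - {0}. f z \<noteq> 0) \<and>
     (\<forall>z\<in>ball 0 1. 1 + (\<delta> - pi) / (2 * sin \<delta>) < Re (log_deriv_quot f z) \<and>
                    Re (log_deriv_quot f z) < 1 + \<delta> / (2 * sin \<delta>))}"

definition is_log_quot :: "(complex \<Rightarrow> complex) \<Rightarrow> (complex \<Rightarrow> complex) \<Rightarrow> bool" where
  "is_log_quot f L \<longleftrightarrow> L holomorphic_on ball 0 1 \<and> L 0 = 0 \<and>
     (\<forall>z\<in>ball 0 1. exp (L z) = z_quot f z)"

text \<open>Only the indices \<open>n \<ge> 1\<close> are meaningful; the index \<open>0\<close> is set to \<open>0\<close> so that the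
  coefficient sequence is unique.\<close>

definition is_log_coeffs :: "(complex \<Rightarrow> complex) \<Rightarrow> (nat \<Rightarrow> complex) \<Rightarrow> bool" where
  "is_log_coeffs f \<gamma> \<longleftrightarrow> \<gamma> 0 = 0 \<and>
     (\<exists>L. is_log_quot f L \<and>
       (\<forall>z\<in>ball 0 1. (\<lambda>n. 2 * \<gamma> (Suc n) * z ^ Suc n) sums L z))"

definition log_coeff :: "(complex \<Rightarrow> complex) \<Rightarrow> nat \<Rightarrow> complex" where
  "log_coeff f = (THE \<gamma>. is_log_coeffs f \<gamma>)"

text \<open>Meaningful for \<open>norm z \<le> 1\<close>.\<close>

definition Li4 :: "complex \<Rightarrow> complex" where
  "Li4 z = (\<Sum>n. z ^ Suc n / of_nat (Suc n) ^ 4)"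

text \<open>Well-definedness of the logarithmic coefficients.\<close>

lemma is_log_quot_exists:
  assumes "f \<in> class_A" and nz: "\<And>z. z \<in> ball 0 1 - {0} \<Longrightarrow> f z \<noteq> 0"
  shows "\<exists>L. is_log_quot f L"
proof -
  have hol: "f holomorphic_on ball 0 1" and f0: "f 0 = 0" and d1: "deriv f 0 = 1"
    using assms(1) by (auto simp: class_A_def)
  have holq: "z_quot f holomorphic_on ball 0 1"
    by (rule pole_theorem_open_0[where g = f and a = 0])
       (use hol f0 d1 in \<open>auto simp: z_quot_def\<close>)
  have nzq: "\<And>z. z \<in> ball 0 1 \<Longrightarrow> z_quot f z \<noteq> 0"
    using nz by (auto simp: z_quot_def)
  obtain g where g: "g holomorphic_on ball 0 1" "\<And>z. z \<in> ball 0 1 \<Longrightarrow> z_quot f z = exp (g z)"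
    using contractible_imp_holomorphic_log[OF holq convex_imp_contractible[OF convex_ball] nzq]
    by blast
  have "exp (g 0) = 1" using g(2)[of 0] by (simp add: z_quot_def)
  hence "is_log_quot f (\<lambda>z. g z - g 0)"
    using g by (auto simp: is_log_quot_def exp_diff intro!: holomorphic_intros)
  thus ?thesis by blast
qed

lemma is_log_quot_unique:
  assumes L: "is_log_quot f L" and M: "is_log_quot f M" and z: "z \<in> ball 0 1"
  shows "L z = M z"
proof -
  define D where "D = (\<lambda>z. L z - M z)"
  have holD: "D holomorphic_on ball 0 1"
    using L M by (auto simp: D_def is_log_quot_def intro!: holomorphic_intros)
  have eD: "exp (D w) = 1" if "w \<in> ball 0 1" for w
  proof -
    have "exp (L w) = exp (M w)" using L M that by (simp add: is_log_quot_def)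
    thus ?thesis by (simp only: D_def exp_diff divide_self[OF exp_not_eq_zero])
  qed
  have der: "(D has_field_derivative 0) (at w within ball 0 1)" if w: "w \<in> ball 0 1" for w
  proof -
    have d: "(D has_field_derivative deriv D w) (at w)"
      using holD w by (simp add: holomorphic_derivI)
    have "((\<lambda>w. exp (D w)) has_field_derivative exp (D w) * deriv D w) (at w)"
      using d by (auto intro!: derivative_eq_intros)
    moreover have "((\<lambda>w. exp (D w)) has_field_derivative 0) (at w)"
      by (rule has_field_derivative_transform_within_open[where f = "\<lambda>_. 1" and S = "ball 0 1"])
         (use w eD in auto)
    ultimately have "exp (D w) * deriv D w = 0" by (rule DERIV_unique)
    thus ?thesis using d by (simp add: has_field_derivative_at_within)
  qed
  have "\<exists>c. \<forall>w\<in>ball 0 1. D w = c"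
    using has_field_derivative_zero_constant[OF convex_ball der] by blast
  hence "D z = D 0" using z by fastforce
  also have "D 0 = 0" using L M by (simp add: D_def is_log_quot_def)
  finally show ?thesis by (simp add: D_def)
qed

lemma is_log_coeffs_ex1:
  assumes "f \<in> class_A" and "\<And>z. z \<in> ball 0 1 - {0} \<Longrightarrow> f z \<noteq> 0"
  shows "\<exists>!\<gamma>. is_log_coeffs f \<gamma>"
proof -
  obtain L where L: "is_log_quot f L" using is_log_quot_exists[OF assms] by blast
  have L0: "L 0 = 0" and holL: "L holomorphic_on ball 0 1"
    using L by (auto simp: is_log_quot_def)
  define g where "g = (\<lambda>n. (deriv ^^ n) L 0 / (2 * fact n))"
  have "(\<lambda>n. 2 * g (Suc n) * z ^ Suc n) sums L z" if "z \<in> ball 0 1" for z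
  proof -
    have "(\<lambda>n. (deriv ^^ n) L 0 / fact n * (z - 0) ^ n) sums L z"
      by (rule holomorphic_power_series[OF holL that])
    hence "(\<lambda>n. 2 * g n * z ^ n) sums L z"
      by (simp add: g_def)
    moreover have "2 * g 0 * z ^ 0 = 0" by (simp add: g_def L0)
    ultimately show ?thesis by (subst sums_Suc_iff) (simp add: g_def L0)
  qed
  moreover have "g 0 = 0" by (simp add: g_def L0)
  ultimately have ex: "is_log_coeffs f g" using L by (auto simp: is_log_coeffs_def)
  have "\<gamma> = \<gamma>'" if a: "is_log_coeffs f \<gamma>" and b: "is_log_coeffs f \<gamma>'" for \<gamma> \<gamma>'
  proof (rule ccontr)
    assume "\<gamma> \<noteq> \<gamma>'"
    then obtain m where m: "\<gamma> m \<noteq> \<gamma>' m" by auto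
    have z0: "\<gamma> 0 = 0" "\<gamma>' 0 = 0" using a b by (auto simp: is_log_coeffs_def)
    have m0: "m > 0" using m z0 by (cases m) auto
    obtain L1 L2 where
      L1: "is_log_quot f L1" "\<And>z. z \<in> ball 0 1 \<Longrightarrow> (\<lambda>n. 2 * \<gamma> (Suc n) * z ^ Suc n) sums L1 z" and
      L2: "is_log_quot f L2" "\<And>z. z \<in> ball 0 1 \<Longrightarrow> (\<lambda>n. 2 * \<gamma>' (Suc n) * z ^ Suc n) sums L2 z"
      using a b unfolding is_log_coeffs_def by blast
    define d where "d = (\<lambda>n. 2 * \<gamma> n - 2 * \<gamma>' n)"
    have s: "(\<lambda>n. d n * (z - 0) ^ n) sums 0" if "norm (z - 0) < 1" for z :: complex
    proof -
      have z: "z \<in> ball 0 1" using that by simp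
      have "(\<lambda>n. 2 * \<gamma> (Suc n) * z ^ Suc n - 2 * \<gamma>' (Suc n) * z ^ Suc n) sums (L1 z - L2 z)"
        by (rule sums_diff[OF L1(2)[OF z] L2(2)[OF z]])
      hence "(\<lambda>n. d (Suc n) * z ^ Suc n) sums 0"
        using is_log_quot_unique[OF L1(1) L2(1) z] by (simp add: d_def algebra_simps)
      hence "(\<lambda>n. d n * z ^ n) sums 0"
        by (subst (asm) sums_Suc_iff) (simp add: d_def z0)
      thus ?thesis by simp
    qed
    have dm: "d m \<noteq> 0" using m by (simp add: d_def)
    show False
    proof (rule powser_0_nonzero[where f = "\<lambda>_. 0" and \<xi> = 0, OF zero_less_one s refl dm m0])
      fix r :: real
      assume r: "0 < r" "\<And>z. z \<in> cball 0 r - {0::complex} \<Longrightarrow> (0::complex) \<noteq> 0"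
      show False using r(2)[of "of_real r"] r(1) by simp
    qed
  qed
  with ex show ?thesis by blast
qed

text \<open>The bracket in the bound is a real number: the two values of \<open>Li4\<close> are conjugate.\<close>

lemma Li4_cnj:
  assumes "norm z \<le> 1"
  shows "Li4 (cnj z) = cnj (Li4 z)"
proof -
  have "summable (\<lambda>n. 1 / real n ^ 4)"
    using inverse_power_summable[of 4, where ?'a = real] by (simp only: inverse_eq_divide)
  hence s: "summable (\<lambda>n. 1 / real (Suc n) ^ 4)" by (rule summable_Suc_iff[THEN iffD2])
  have "norm (z ^ Suc n / of_nat (Suc n) ^ 4) \<le> 1 / real (Suc n) ^ 4" for n
  proof -
    have "norm (z ^ Suc n / of_nat (Suc n) ^ 4) = norm z ^ Suc n / real (Suc n) ^ 4"
      by (simp only: norm_divide norm_power norm_of_nat)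
    also have "\<dots> \<le> 1 / real (Suc n) ^ 4"
      by (intro divide_right_mono power_le_one assms norm_ge_zero zero_le_power of_nat_0_le_iff)
    finally show ?thesis .
  qed
  hence "summable (\<lambda>n. z ^ Suc n / of_nat (Suc n) ^ 4)"
    by (intro summable_comparison_test'[OF s])
  hence "(\<lambda>n. z ^ Suc n / of_nat (Suc n) ^ 4) sums Li4 z"
    unfolding Li4_def by (rule summable_sums)
  hence "(\<lambda>n. cnj (z ^ Suc n / of_nat (Suc n) ^ 4)) sums cnj (Li4 z)"
    by (rule sums_cnj[THEN iffD2])
  hence "(\<lambda>n. cnj z ^ Suc n / of_nat (Suc n) ^ 4) sums cnj (Li4 z)"
    by (simp only: complex_cnj_divide complex_cnj_power complex_cnj_of_nat)
  thus ?thesis unfolding Li4_def by (rule sums_unique[symmetric])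
qed

lemma bracket_real:
  "Im (complex_of_real (pi ^ 4 / 45) - Li4 (exp (- 2 * \<i> * complex_of_real \<delta>))
        - Li4 (exp (2 * \<i> * complex_of_real \<delta>))) = 0"
proof -
  have "cnj (exp (2 * \<i> * complex_of_real \<delta>)) = exp (- 2 * \<i> * complex_of_real \<delta>)"
    by (simp add: exp_cnj)
  moreover have "norm (exp (2 * \<i> * complex_of_real \<delta>)) \<le> 1" by simp
  ultimately have "Li4 (exp (- 2 * \<i> * complex_of_real \<delta>)) = cnj (Li4 (exp (2 * \<i> * complex_of_real \<delta>)))"
    using Li4_cnj[of "exp (2 * \<i> * complex_of_real \<delta>)"] by argo
  thus ?thesis by (simp only: minus_complex.simps complex_cnj Im_complex_of_real) simp
qed
end

theory Submission
  imports Defs "HOL-Real_Asymp.Real_Asymp"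
begin

text \<open>Let \<open>p(z) = z f'(z) / f(z) - 1 = \<Sum> 2 n \<gamma>\<^sub>n z\<^sup>n\<close>. Membership in \<^const>\<open>class_M\<close> means that \<open>p\<close> is
  subordinate to the conformal map \<open>B\<close> of the disc onto a vertical strip, whose coefficients are
  \<open>A\<^sub>n = \<plusminus> sin (n \<delta>) / (n sin \<delta>)\<close>. Rogosinski's inequality bounds every partial sum of
  \<open>\<bar>2 n \<gamma>\<^sub>n\<bar>\<^sup>2\<close> by that of \<open>\<bar>A\<^sub>n\<bar>\<^sup>2\<close>, and summation by parts with the decreasing weights \<open>1 / (4 n\<^sup>2)\<close>
  gives \<open>\<Sum> \<bar>\<gamma>\<^sub>n\<bar>\<^sup>2 \<le> \<Sum> \<bar>A\<^sub>n\<bar>\<^sup>2 / (4 n\<^sup>2)\<close>. As \<open>2 sin\<^sup>2 (n \<delta>) = 1 - cos (2 n \<delta>)\<close>, the right-hand side is the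
  stated combination of \<open>Li\<^sub>4\<close> and \<open>\<Sum> 1 / n ^ 4 = pi ^ 4 / 90\<close>. Equality holds for the \<open>f\<close> with \<open>p = B\<close>.\<close>

section \<open>Rogosinski's inequality\<close>

text \<open>This is Parseval's identity for the discrete Fourier transform. Expanding the square
  leaves sums over \<open>j\<close> of \<open>w ^ j\<close> with \<open>w ^ N = 1\<close>; such a
  geometric sum vanishes unless \<open>w = 1\<close>. As both exponents lie below \<open>N\<close>,
  this happens only for \<open>k = l\<close>.\<close>

lemma sum_norm_sq_roots_of_unity:
  fixes a :: "nat \<Rightarrow> complex"
  assumes "N > 0"
  shows "(\<Sum>j<N. (norm (\<Sum>k<N. a k * cis (2 * pi * real j / real N) ^ k))\<^sup>2) = real N * (\<Sum>k<N. (norm (a k))\<^sup>2)"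
proof -
  define \<zeta> where "\<zeta> = (\<lambda>j::nat. cis (2 * pi * j / N))"
  have orth: "(\<Sum>j<N. \<zeta> j ^ k * cnj (\<zeta> j ^ l)) = (if k = l then of_nat N else 0)" 
    if kl: "k < N" "l < N" for k l
  proof -
    define w where "w = cis (2 * pi * (real k - real l) / N)"
    have "\<zeta> j ^ k * cnj (\<zeta> j ^ l) = w ^ j" for j
    proof -
      have "\<zeta> j ^ k * cnj (\<zeta> j ^ l) = cis (real k * (2 * pi * j / N) + real l * - (2 * pi * j / N))"
        by (simp only: \<zeta>_def complex_cnj_power cis_cnj Complex.DeMoivre cis_mult mult_minus_right)
      also have "real k * (2 * pi * j / N) + real l * - (2 * pi * j / N) = j * (2 * pi * (real k - real l) / N)"
        by (simp add: algebra_simps diff_divide_distrib)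
      finally show ?thesis by (simp add: w_def Complex.DeMoivre)
    qed
    moreover have "(\<Sum>j<N. w ^ j) = (if k = l then of_nat N else 0)"
    proof (cases "k = l")
      case False
      have "w \<noteq> 1"
      proof
        assume "w = 1"
        hence "cos (2 * pi * (real k - real l) / N) = 1"
          by (auto simp: w_def complex_eq_iff)
        then obtain m :: int where "2 * pi * (real k - real l) / N = real_of_int m * 2 * pi"
          unfolding cos_one_2pi_int by blast
        hence "2 * pi * (real k - real l) = 2 * pi * (m * N)" using assms by (simp add: field_simps)
        hence "real k - real l = m * N" using pi_gt_zero by (simp only: mult_cancel_left) simp
        hence "real_of_int (int k - int l) = real_of_int (m * int N)" by simp
        hence *: "int k - int l = m * int N" by (simp only: of_int_eq_iff)
        hence "int N dvd int k - int l" by simp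
        hence "int k mod int N = int l mod int N" by (simp add: mod_eq_dvd_iff)
        thus False using kl False by simp
      qed
      moreover have "w ^ N = 1"
      proof -
        have "w ^ N = cis (2 * pi * (int k - int l))"
          using assms by (simp add: w_def Complex.DeMoivre)
        thus ?thesis by (metis cis_multiple_2pi Ints_of_int)
      qed
      ultimately show ?thesis using False by (simp add: geometric_sum)
    qed (simp add: w_def)
    ultimately show ?thesis by simp
  qed
  have "complex_of_real (\<Sum>j<N. (norm (\<Sum>k<N. a k * \<zeta> j ^ k))\<^sup>2) =
        (\<Sum>j<N. (\<Sum>k<N. a k * \<zeta> j ^ k) * cnj (\<Sum>l<N. a l * \<zeta> j ^ l))"
    by (simp only: of_real_sum complex_norm_square)
  also have "\<dots> = (\<Sum>j<N. \<Sum>k<N. \<Sum>l<N. a k * cnj (a l) * (\<zeta> j ^ k * cnj (\<zeta> j ^ l)))"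
    by (simp add: sum_product cnj_sum algebra_simps)
  also have "\<dots> = (\<Sum>k<N. \<Sum>j<N. \<Sum>l<N. a k * cnj (a l) * (\<zeta> j ^ k * cnj (\<zeta> j ^ l)))"
    by (rule sum.swap)
  also have "\<dots> = (\<Sum>k<N. \<Sum>l<N. \<Sum>j<N. a k * cnj (a l) * (\<zeta> j ^ k * cnj (\<zeta> j ^ l)))"
    by (intro sum.cong refl sum.swap)
  also have "\<dots> = (\<Sum>k<N. \<Sum>l<N. a k * cnj (a l) * (if k = l then of_nat N else 0))"
    by (intro sum.cong refl) (simp add: sum_distrib_left [symmetric] orth del: complex_cnj_power)
  also have "\<dots> = (\<Sum>k<N. a k * cnj (a k) * of_nat N)"
    by (intro sum.cong refl) (simp add: if_distrib sum.delta cong: if_cong)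
  also have "\<dots> = complex_of_real (N * (\<Sum>k<N. (norm (a k))\<^sup>2))"
    by (simp add: sum_distrib_left complex_norm_square mult_ac del: of_real_power)
  finally show ?thesis unfolding \<zeta>_def of_real_eq_iff .
qed

text \<open>A truncation of \<open>H\<close> changes neither side, so \<open>H\<close> may be taken to be a polynomial; then compare
  the means of \<open>\<bar>\<Phi> H\<bar>\<^sup>2\<close> and \<open>\<bar>H\<bar>\<^sup>2\<close> over roots of unity on circles of radius \<open>r < 1\<close>.\<close>

lemma fps_mult_bounded_sum_norm_sq_le:
  fixes \<Phi> H :: "complex fps"
  assumes conv: "fps_conv_radius \<Phi> \<ge> 1"
    and bd: "\<And>z. norm z < 1 \<Longrightarrow> norm (eval_fps \<Phi> z) \<le> 1"
  shows "(\<Sum>k\<le>n. (norm (fps_nth (\<Phi> * H) k))\<^sup>2) \<le> (\<Sum>k\<le>n. (norm (fps_nth H k))\<^sup>2)"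
proof -
  define Q where "Q = fps_cutoff (Suc n) H"
  define F where "F = \<Phi> * Q"
  have Fn: "fps_nth F k = fps_nth (\<Phi> * H) k" if "k \<le> n" for k
    using that by (auto simp: F_def Q_def fps_mult_nth intro!: sum.cong)
  have Qn: "fps_nth Q k = (if k \<le> n then fps_nth H k else 0)" for k
    by (auto simp: Q_def)
  have Qc: "fps_conv_radius Q = \<infinity>"
  proof -
    have "fps_nth Q = (\<lambda>k. if k \<le> n then fps_nth H k else 0)" using Qn by blast
    moreover have "conv_radius (\<lambda>k. if k \<le> n then fps_nth H k else 0) = conv_radius (\<lambda>_. 0 :: complex)"
      by (rule conv_radius_cong, rule eventually_mono[OF eventually_gt_at_top[of n]]) auto
    ultimately show ?thesis by (simp add: fps_conv_radius_def)
  qed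
  have Fc: "fps_conv_radius F \<ge> 1"
    using fps_conv_radius_mult[of \<Phi> Q] conv Qc by (simp add: F_def)
  have Fle: "norm (eval_fps F z) \<le> norm (eval_fps Q z)" if z: "norm z < 1" for z
  proof -
    have "ereal (norm z) < fps_conv_radius \<Phi>" using z conv
      by (metis ereal_less(3) less_le_trans)
    hence "eval_fps F z = eval_fps \<Phi> z * eval_fps Q z"
      unfolding F_def by (intro eval_fps_mult) (auto simp: Qc)
    thus ?thesis using bd[OF z] by (simp add: norm_mult mult_left_le_one_le)
  qed
  have evQ: "eval_fps Q z = (\<Sum>k<N. fps_nth Q k * z ^ k)" if "N > n" for N z
    unfolding eval_fps_def by (rule suminf_finite) (use that Qn in auto)
  have main: "(\<Sum>k\<le>n. (norm (fps_nth (\<Phi> * H) k))\<^sup>2 * (r\<^sup>2) ^ k) \<le> (\<Sum>k\<le>n. (norm (fps_nth H k))\<^sup>2 * (r\<^sup>2) ^ k)"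
    if r: "0 < r" "r < 1" for r :: real
  proof -
    \<comment> \<open>\<open>M\<close> bounds \<open>Q\<close> on the circle of radius
      \<open>r\<close> independently of \<open>N\<close>, so the cross term
      \<open>2 * M * \<epsilon> N\<close> below tends to \<open>0\<close>.\<close>
    define M where "M = (\<Sum>k\<le>n. norm (fps_nth H k) * r ^ k)"
    have rr: "ereal (norm r) < fps_conv_radius F" using r Fc by (metis ereal_less(3) less_le_trans norm_of_real abs_of_pos real_norm_def)
    have smb: "summable (\<lambda>k. norm (fps_nth F k) * r ^ k)"
      using norm_summable_fps[of "complex_of_real r" F] rr r by (simp add: norm_mult norm_power)
    \<comment> \<open>Discrete Parseval applies to polynomials of degree below \<open>N\<close>
      only, whereas \<open>F\<close> is a power series. \<open>\<epsilon> N\<close> bounds the tail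
      of \<open>F\<close> cut off on the circle of radius \<open>r\<close>.\<close>
    define \<epsilon> where "\<epsilon> = (\<lambda>N. \<Sum>k. norm (fps_nth F (k + N)) * r ^ (k + N))"
    have \<epsilon>0: "\<epsilon> \<longlonglongrightarrow> 0" unfolding \<epsilon>_def using smb by (rule suminf_exist_split2)
    have bound: "(\<Sum>k\<le>n. (norm (fps_nth (\<Phi> * H) k))\<^sup>2 * (r\<^sup>2) ^ k) \<le>
       (\<Sum>k\<le>n. (norm (fps_nth H k))\<^sup>2 * (r\<^sup>2) ^ k) + (2 * M * \<epsilon> N + (\<epsilon> N)\<^sup>2)" if N: "N > n" for N
    proof -
      have N0: "N > 0" using N by simp
      define \<zeta> where "\<zeta> = (\<lambda>j::nat. cis (2 * pi * j / N))"
      define T where "T = (\<lambda>z. \<Sum>k<N. fps_nth F k * z ^ k)"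
      have T: "(norm (T (r * \<zeta> j)))\<^sup>2 \<le> (norm (eval_fps Q (r * \<zeta> j)))\<^sup>2 + (2 * M * \<epsilon> N + (\<epsilon> N)\<^sup>2)" for j
      proof -
        define z where "z = r * \<zeta> j"
        have nz: "norm z = r" using r by (simp add: z_def \<zeta>_def norm_mult)
        have sF: "summable (\<lambda>k. fps_nth F k * z ^ k)" 
          by (rule summable_fps) (use rr nz r in simp)
        have sN: "summable (\<lambda>k. norm (fps_nth F (k + N) * z ^ (k + N)))"
          using summable_ignore_initial_segment[OF smb, of N] by (simp add: norm_mult norm_power nz)
        have "eval_fps F z = T z + (\<Sum>k. fps_nth F (k + N) * z ^ (k + N))"
          unfolding eval_fps_def T_def using suminf_split_initial_segment[OF sF, of N] by simp
        moreover have "norm (\<Sum>k. fps_nth F (k + N) * z ^ (k + N)) \<le> \<epsilon> N"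
          unfolding \<epsilon>_def using summable_norm[OF sN] by (simp add: norm_mult norm_power nz)
        ultimately have "norm (T z) \<le> norm (eval_fps F z) + \<epsilon> N"
          by (smt (verit) add_diff_cancel_right' norm_triangle_ineq4)
        also have "norm (eval_fps F z) \<le> norm (eval_fps Q z)" using Fle nz r by simp
        finally have "(norm (T z))\<^sup>2 \<le> (norm (eval_fps Q z) + \<epsilon> N)\<^sup>2" by (simp add: power_mono)
        also have "\<dots> = (norm (eval_fps Q z))\<^sup>2 + (2 * norm (eval_fps Q z) * \<epsilon> N + (\<epsilon> N)\<^sup>2)"
          by (simp add: power2_sum)
        also have "\<dots> \<le> (norm (eval_fps Q z))\<^sup>2 + (2 * M * \<epsilon> N + (\<epsilon> N)\<^sup>2)"
        proof -
          have "norm (eval_fps Q z) \<le> (\<Sum>k<Suc n. norm (fps_nth Q k * z ^ k))"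
            unfolding evQ[OF lessI] by (rule norm_sum)
          also have "\<dots> = M" unfolding M_def lessThan_Suc_atMost 
            by (intro sum.cong) (auto simp: Qn norm_mult norm_power nz)
          finally have "norm (eval_fps Q z) \<le> M" .
          moreover have "\<epsilon> N \<ge> 0" unfolding \<epsilon>_def using r
            by (intro suminf_nonneg summable_ignore_initial_segment[OF smb]) auto
          ultimately show ?thesis by (simp add: mult_right_mono)
        qed
        finally show ?thesis unfolding z_def .
      qed
      \<comment> \<open>The radius is absorbed into the coefficients: Parseval is applied to
        \<open>fps_nth G k * r ^ k\<close>.\<close>
      have pars: "(\<Sum>j<N. (norm (\<Sum>k<N. fps_nth G k * (r * \<zeta> j) ^ k))\<^sup>2) = N * (\<Sum>k<N. (norm (fps_nth G k))\<^sup>2 * (r\<^sup>2) ^ k)"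
        for G :: "complex fps"
        using sum_norm_sq_roots_of_unity[OF N0, of "\<lambda>k. fps_nth G k * r ^ k"] r
        by (simp add: \<zeta>_def power_mult_distrib mult.assoc norm_mult norm_power flip: power_mult)
           (simp add: mult.commute)
      have "N * (\<Sum>k\<le>n. (norm (fps_nth (\<Phi> * H) k))\<^sup>2 * (r\<^sup>2) ^ k) = N * (\<Sum>k\<le>n. (norm (fps_nth F k))\<^sup>2 * (r\<^sup>2) ^ k)"
        using Fn by simp
      \<comment> \<open>\<open>F\<close> may have nonzero coefficients between \<open>n\<close> and
        \<open>N\<close>; enlarging the sum by them only increases it. On the side of
        \<open>Q\<close> the corresponding terms are zero.\<close>
      also have "\<dots> \<le> N * (\<Sum>k<N. (norm (fps_nth F k))\<^sup>2 * (r\<^sup>2) ^ k)"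
        using N r by (intro mult_left_mono sum_mono2) auto
      also have "\<dots> = (\<Sum>j<N. (norm (T (r * \<zeta> j)))\<^sup>2)" using pars[of F] by (simp add: T_def)
      also have "\<dots> \<le> (\<Sum>j<N. (norm (eval_fps Q (r * \<zeta> j)))\<^sup>2 + (2 * M * \<epsilon> N + (\<epsilon> N)\<^sup>2))"
        by (intro sum_mono T)
      also have "\<dots> = N * (\<Sum>k<N. (norm (fps_nth Q k))\<^sup>2 * (r\<^sup>2) ^ k) + N * (2 * M * \<epsilon> N + (\<epsilon> N)\<^sup>2)"
        using pars[of Q] by (simp add: sum.distrib evQ[OF N])
      also have "(\<Sum>k<N. (norm (fps_nth Q k))\<^sup>2 * (r\<^sup>2) ^ k) = (\<Sum>k\<le>n. (norm (fps_nth H k))\<^sup>2 * (r\<^sup>2) ^ k)"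
        using N by (intro sum.mono_neutral_cong_right) (auto simp: Qn)
      finally show ?thesis using N0 by (simp add: distrib_left [symmetric])
    qed
    have "(\<lambda>N. (\<Sum>k\<le>n. (norm (fps_nth H k))\<^sup>2 * (r\<^sup>2) ^ k) + (2 * M * \<epsilon> N + (\<epsilon> N)\<^sup>2)) \<longlonglongrightarrow>
        (\<Sum>k\<le>n. (norm (fps_nth H k))\<^sup>2 * (r\<^sup>2) ^ k) + (2 * M * 0 + 0\<^sup>2)"
      by (intro tendsto_intros \<epsilon>0)
    thus ?thesis
      by (intro tendsto_lowerbound[of _ _ sequentially])
         (auto intro!: eventually_mono[OF eventually_gt_at_top[of n]] bound)
  qed
  \<comment> \<open>Both sides are polynomials in \<open>r\<close>, so the inequality for
    \<open>r < 1\<close> passes to the limit \<open>r = 1\<close>.\<close>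
  have lim: "((\<lambda>r. \<Sum>k\<le>n. (norm (fps_nth G k))\<^sup>2 * (r\<^sup>2) ^ k) \<longlongrightarrow> (\<Sum>k\<le>n. (norm (fps_nth G k))\<^sup>2 * (1\<^sup>2) ^ k)) (at_left (1::real))"
    for G :: "complex fps" by (intro tendsto_intros)
  have "(\<Sum>k\<le>n. (norm (fps_nth (\<Phi> * H) k))\<^sup>2 * (1\<^sup>2) ^ k) \<le> (\<Sum>k\<le>n. (norm (fps_nth H k))\<^sup>2 * ((1::real)\<^sup>2) ^ k)"
    by (rule tendsto_le[OF _ lim lim]) 
       (auto intro!: eventually_mono[OF eventually_at_left_real[of 0 1]] main)
  thus ?thesis by simp
qed

text \<open>Writing \<open>F = F 0 + X S\<close> gives \<open>F \<circ> W = F 0 + X \<Phi> (S \<circ> W)\<close> for \<open>W = X \<Phi>\<close>, and multiplication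
  by \<open>\<Phi>\<close> does not increase truncated sums of squares.\<close>

theorem rogosinski_fps:
  fixes \<Phi> F :: "complex fps"
  assumes conv: "fps_conv_radius \<Phi> \<ge> 1"
    and bd: "\<And>z. norm z < 1 \<Longrightarrow> norm (eval_fps \<Phi> z) \<le> 1"
  shows "(\<Sum>k\<le>n. (norm (fps_nth (F oo (fps_X * \<Phi>)) k))\<^sup>2) \<le> (\<Sum>k\<le>n. (norm (fps_nth F k))\<^sup>2)"
proof (induction n arbitrary: F)
  case 0
  show ?case by simp
next
  case (Suc n)
  define S where "S = fps_shift 1 F"
  let ?W = "fps_X * \<Phi>"
  have F: "F = fps_const (fps_nth F 0) + fps_X * S"
    by (simp add: fps_eq_iff S_def)
  have "F oo ?W = fps_const (fps_nth F 0) + ?W * (S oo ?W)"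
    by (subst F) (simp add: fps_compose_add_distrib fps_compose_mult_distrib)
  hence comp: "fps_nth (F oo ?W) (Suc k) = fps_nth (\<Phi> * (S oo ?W)) k" for k
    by (simp add: mult.assoc)
  have "(\<Sum>k\<le>Suc n. (norm (fps_nth (F oo ?W) k))\<^sup>2) =
        (norm (fps_nth F 0))\<^sup>2 + (\<Sum>k\<le>n. (norm (fps_nth (\<Phi> * (S oo ?W)) k))\<^sup>2)"
    by (simp add: sum.atMost_Suc_shift comp del: sum.atMost_Suc)
  also have "\<dots> \<le> (norm (fps_nth F 0))\<^sup>2 + (\<Sum>k\<le>n. (norm (fps_nth (S oo ?W) k))\<^sup>2)"
    by (intro add_left_mono fps_mult_bounded_sum_norm_sq_le conv bd)
  also have "\<dots> \<le> (norm (fps_nth F 0))\<^sup>2 + (\<Sum>k\<le>n. (norm (fps_nth S k))\<^sup>2)"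
    by (intro add_left_mono Suc.IH)
  also have "\<dots> = (\<Sum>k\<le>Suc n. (norm (fps_nth F k))\<^sup>2)"
    by (simp add: sum.atMost_Suc_shift S_def del: sum.atMost_Suc)
  finally show ?case .
qed

text \<open>By the Schwarz lemma \<open>\<omega> z = z * h z\<close> with \<open>h\<close> bounded
  by 1. Hence the expansion of \<open>\<omega>\<close> is \<open>fps_X * \<Phi>\<close> with
  \<open>\<Phi>\<close> bounded by 1 on the disc, and composition of functions becomes composition
  of formal series.\<close>

theorem rogosinski_subordination:
  fixes G \<omega> :: "complex \<Rightarrow> complex"
  assumes G: "G has_fps_expansion F"
    and hol: "\<omega> holomorphic_on ball 0 1" and zero: "\<omega> 0 = 0"
    and bd: "\<And>z. norm z < 1 \<Longrightarrow> norm (\<omega> z) < 1"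
    and g: "g has_fps_expansion E" and sub: "\<And>z. norm z < 1 \<Longrightarrow> g z = G (\<omega> z)"
  shows "(\<Sum>k\<le>n. (norm (fps_nth E k))\<^sup>2) \<le> (\<Sum>k\<le>n. (norm (fps_nth F k))\<^sup>2)"
proof -
  obtain h where h: "h holomorphic_on ball 0 1" "\<And>z. norm z < 1 \<Longrightarrow> \<omega> z = z * h z" "deriv \<omega> 0 = h 0"
    using Schwarz3[OF hol zero] by blast
  \<comment> \<open>Away from the origin one divides by \<open>norm z\<close>; at the origin
    \<open>h 0\<close> is \<open>deriv \<omega> 0\<close>, which the Schwarz lemma bounds as
    well.\<close>
  have hle: "norm (h z) \<le> 1" if z: "norm z < 1" for z
  proof (cases "z = 0")
    case True
    thus ?thesis using Schwarz_Lemma(2)[OF hol zero bd z] h(3) by simp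
  next
    case False
    thus ?thesis using Schwarz_Lemma(1)[OF hol zero bd z] h(2)[OF z] by (simp add: norm_mult)
  qed
  define \<Phi> where "\<Phi> = fps_expansion h 0"
  have \<Phi>: "h has_fps_expansion \<Phi>"
    unfolding \<Phi>_def using h(1) by (intro has_fps_expansion_fps_expansion[of "ball 0 1"]) auto
  have conv: "fps_conv_radius \<Phi> \<ge> 1"
    by (rule holomorphic_on_imp_fps_conv_radius_ge[OF \<Phi>])
       (use h(1) in \<open>simp add: one_ereal_def\<close>)
  have ev: "norm (eval_fps \<Phi> z) \<le> 1" if "norm z < 1" for z
    using has_fps_expansion_imp_eval_fps_eq[OF \<Phi> that h(1)] hle[OF that] by simp
  have near: "eventually (\<lambda>z::complex. norm z < 1) (nhds 0)"
    using eventually_nhds_in_open[of "ball 0 1" "0::complex"] by simp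
  have "(\<lambda>z. z * h z) has_fps_expansion fps_X * \<Phi>"
    by (intro fps_expansion_intros \<Phi>)
  hence "\<omega> has_fps_expansion fps_X * \<Phi>"
    by (subst has_fps_expansion_cong[OF eventually_mono[OF near h(2)] refl])
  hence "(G \<circ> \<omega>) has_fps_expansion (F oo (fps_X * \<Phi>))"
    by (intro has_fps_expansion_compose G) auto
  hence "g has_fps_expansion (F oo (fps_X * \<Phi>))"
    by (subst has_fps_expansion_cong[OF _ refl, where g = "G \<circ> \<omega>"])
       (auto intro: eventually_mono[OF near] simp: sub)
  hence "E = F oo (fps_X * \<Phi>)" using g by (rule fps_expansion_unique_complex[rotated])
  thus ?thesis using rogosinski_fps[OF conv ev] by simp
qed

text \<open>Summation by parts: the weighted sum of \<open>b - a\<close> becomes a combination of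
  its partial sums \<open>D\<close>, with coefficients \<open>w n\<close> and
  \<open>w k - w (Suc k)\<close>. All of these are nonnegative.\<close>

lemma weighted_sum_le_of_partial_sums_le:
  fixes a b w :: "nat \<Rightarrow> real"
  assumes partial: "\<And>n. (\<Sum>k\<le>n. a k) \<le> (\<Sum>k\<le>n. b k)"
    and w: "decseq w" "\<And>n. w n \<ge> 0"
  shows "(\<Sum>k\<le>n. w k * a k) \<le> (\<Sum>k\<le>n. w k * b k)"
proof -
  define D where "D = (\<lambda>n. \<Sum>k\<le>n. b k - a k)"
  have D: "D n \<ge> 0" for n using partial[of n] by (simp add: D_def sum_subtractf)
  have abel: "(\<Sum>k\<le>n. w k * (b k - a k)) = w n * D n + (\<Sum>k<n. (w k - w (Suc k)) * D k)"
    by (induction n) (auto simp: D_def algebra_simps)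
  have "(\<Sum>k\<le>n. w k * (b k - a k)) \<ge> 0"
    unfolding abel using w D by (intro add_nonneg_nonneg sum_nonneg mult_nonneg_nonneg) (auto simp: decseq_Suc_iff)
  thus ?thesis by (simp add: right_diff_distrib sum_subtractf)
qed

section \<open>The sum of inverse fourth powers\<close>

text \<open>In each case the difference of the two sides vanishes at \<open>0\<close> and has a
  nonnegative derivative, \<open>t^2 / (1 - t)\<close> and
  \<open>t^2 * (2 - 3 * t) / (1 - t)\<close> respectively; \<open>y \<le> 1 / 2\<close> keeps
  \<open>2 - 3 * t\<close> positive.\<close>

lemma neg_ln_one_minus_bounds:
  fixes y :: real
  assumes "0 \<le> y" "y \<le> 1 / 2"
  shows "y + y\<^sup>2 / 2 \<le> - ln (1 - y)" and "- ln (1 - y) \<le> y + y\<^sup>2 / 2 + y ^ 3"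
proof -
  have "- ln (1 - 0) - 0 - 0\<^sup>2 / 2 \<le> - ln (1 - y) - y - y\<^sup>2 / 2"
  proof (rule DERIV_nonneg_imp_nondecreasing[OF assms(1)])
    fix t :: real assume t: "0 \<le> t" "t \<le> y"
    have "((\<lambda>t. - ln (1 - t) - t - t\<^sup>2 / 2) has_real_derivative 1 / (1 - t) - 1 - t) (at t)"
      using t assms by (auto intro!: derivative_eq_intros simp: field_simps)
    moreover have "1 / (1 - t) - 1 - t = t\<^sup>2 / (1 - t)"
      using t assms by (simp add: field_simps power2_eq_square)
    moreover have "t\<^sup>2 / (1 - t) \<ge> 0" using t assms by simp
    ultimately show "\<exists>d. ((\<lambda>t. - ln (1 - t) - t - t\<^sup>2 / 2) has_real_derivative d) (at t) \<and> 0 \<le> d" by auto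
  qed
  thus "y + y\<^sup>2 / 2 \<le> - ln (1 - y)" by simp
  have "0 + 0\<^sup>2 / 2 + 0 ^ 3 + ln (1 - 0) \<le> y + y\<^sup>2 / 2 + y ^ 3 + ln (1 - y)"
  proof (rule DERIV_nonneg_imp_nondecreasing[OF assms(1)])
    fix t :: real assume t: "0 \<le> t" "t \<le> y"
    have "((\<lambda>t. t + t\<^sup>2 / 2 + t ^ 3 + ln (1 - t)) has_real_derivative 1 + t + 3 * t\<^sup>2 - 1 / (1 - t)) (at t)"
      using t assms by (auto intro!: derivative_eq_intros simp: field_simps)
    moreover have "1 + t + 3 * t\<^sup>2 - 1 / (1 - t) = t\<^sup>2 * (2 - 3 * t) / (1 - t)"
      using t assms by (simp add: field_simps power2_eq_square)
    moreover have "t\<^sup>2 * (2 - 3 * t) / (1 - t) \<ge> 0" using t assms by simp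
    ultimately show "\<exists>d. ((\<lambda>t. t + t\<^sup>2 / 2 + t ^ 3 + ln (1 - t)) has_real_derivative d) (at t) \<and> 0 \<le> d" by auto
  qed
  thus "- ln (1 - y) \<le> y + y\<^sup>2 / 2 + y ^ 3" by simp
qed

text \<open>Taking logarithms in the product formula for \<open>sin (pi x)\<close> and expanding to second order in \<open>x\<^sup>2\<close>,
  the coefficient of \<open>x ^ 4\<close> is half the sum.\<close>

theorem inverse_fourth_powers_sums: "(\<lambda>n. 1 / real (Suc n) ^ 4) sums (pi ^ 4 / 90)"
proof -
  have sm: "summable (\<lambda>n. 1 / real (Suc n) ^ 4)"
    using inverse_power_summable[of 4, where ?'a = real]
    by (subst summable_Suc_iff) (simp add: inverse_eq_divide)
  define Z where "Z = (\<Sum>n. 1 / real (Suc n) ^ 4)"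
  have Z: "(\<lambda>n. 1 / real (Suc n) ^ 4) sums Z" unfolding Z_def by (rule summable_sums[OF sm])
  have Z2: "(\<lambda>n. 1 / real (Suc n) ^ 2) sums (pi\<^sup>2 / 6)"
    using inverse_squares_sums by (simp add: add.commute)
  \<comment> \<open>The logarithm bounds are summed over the factors \<open>1 - y n\<close> of the
    sine product, \<open>y n = x^2 / (n + 1)^2\<close>. The terms \<open>y n\<close> sum to
    \<open>x^2 * (pi^2 / 6)\<close> and their squares to \<open>x^4 * Z\<close>; the cubes are
    controlled by \<open>y n \<le> x^2\<close>.\<close>
  have bounds: "Z \<le> 2 * (- ln (sin (pi * x) / (pi * x)) - x\<^sup>2 * (pi\<^sup>2 / 6)) / x ^ 4"
    "2 * (- ln (sin (pi * x) / (pi * x)) - x\<^sup>2 * (pi\<^sup>2 / 6)) / x ^ 4 \<le> Z + 2 * x\<^sup>2 * Z"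
    if x: "0 < x" "x < 1 / 2" for x :: real
  proof -
    define y where "y = (\<lambda>n. x\<^sup>2 / real (Suc n) ^ 2)"
    have x2: "x\<^sup>2 \<le> 1 / 2" using x by (smt (verit) field_sum_of_halves power2_le_imp_le power_le_one zero_less_power mult_left_le_one_le power2_eq_square)
    have y: "0 \<le> y n" "y n \<le> 1 / 2" for n
    proof -
      have "y n \<le> x\<^sup>2" unfolding y_def using x by (simp add: divide_le_eq mult_le_cancel_left1 del: of_nat_Suc)
      thus "y n \<le> 1 / 2" using x2 by simp
    qed (simp add: y_def)
    have s1: "y sums (x\<^sup>2 * (pi\<^sup>2 / 6))"
      using sums_mult[OF Z2, of "x\<^sup>2"] by (simp add: y_def)
    have s2: "(\<lambda>n. (y n)\<^sup>2) sums (x ^ 4 * Z)"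
      using sums_mult[OF Z, of "x ^ 4"] by (simp add: y_def power_divide flip: power_mult)
    have s3: "(\<lambda>n. x\<^sup>2 * (y n)\<^sup>2) sums (x\<^sup>2 * (x ^ 4 * Z))" by (rule sums_mult[OF s2])
    have pos: "sin (pi * x) / (pi * x) > 0"
      using x by (intro divide_pos_pos sin_gt_zero mult_pos_pos) auto
    have "(\<lambda>n. ln (\<Prod>k=1..n. 1 - x\<^sup>2 / (of_nat k)\<^sup>2)) \<longlonglongrightarrow> ln (sin (pi * x) / (pi * x))"
      using x pos by (intro tendsto_ln sin_product_formula_real') auto
    moreover have "(\<Prod>k=1..n. 1 - x\<^sup>2 / (of_nat k)\<^sup>2) = (\<Prod>k<n. 1 - y k)" for n
      unfolding y_def by (rule prod.reindex_bij_witness[of _ Suc "\<lambda>k. k - 1"]) auto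
    moreover have "ln (\<Prod>k<n. 1 - y k) = (\<Sum>k<n. ln (1 - y k))" for n
    proof (rule ln_prod)
      fix k show "1 - y k \<noteq> 0" using y(2)[of k] by linarith
    qed simp
    ultimately have "(\<lambda>n. ln (1 - y n)) sums ln (sin (pi * x) / (pi * x))" by (simp add: sums_def)
    hence s: "(\<lambda>n. - ln (1 - y n)) sums (- ln (sin (pi * x) / (pi * x)))" by (rule sums_minus)
    have "x\<^sup>2 * (pi\<^sup>2 / 6) + x ^ 4 * Z / 2 \<le> - ln (sin (pi * x) / (pi * x))"
      by (rule sums_le[OF _ sums_add[OF s1 sums_divide[OF s2]] s])
         (use neg_ln_one_minus_bounds(1) y in auto)
    thus "Z \<le> 2 * (- ln (sin (pi * x) / (pi * x)) - x\<^sup>2 * (pi\<^sup>2 / 6)) / x ^ 4"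
      using x by (simp add: field_simps)
    have le: "- ln (1 - y n) \<le> y n + (y n)\<^sup>2 / 2 + x\<^sup>2 * (y n)\<^sup>2" for n
    proof -
      have "y n \<le> x\<^sup>2" unfolding y_def using x by (simp add: divide_le_eq mult_le_cancel_left1 del: of_nat_Suc)
      hence "y n * (y n)\<^sup>2 \<le> x\<^sup>2 * (y n)\<^sup>2" by (intro mult_right_mono) auto
      hence "y n ^ 3 \<le> x\<^sup>2 * (y n)\<^sup>2" by (simp add: power3_eq_cube power2_eq_square mult.assoc)
      thus ?thesis using neg_ln_one_minus_bounds(2)[OF y[of n]] by simp
    qed
    have "- ln (sin (pi * x) / (pi * x)) \<le> x\<^sup>2 * (pi\<^sup>2 / 6) + x ^ 4 * Z / 2 + x\<^sup>2 * (x ^ 4 * Z)"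
      by (rule sums_le[OF le s sums_add[OF sums_add[OF s1 sums_divide[OF s2]] s3]])
    thus "2 * (- ln (sin (pi * x) / (pi * x)) - x\<^sup>2 * (pi\<^sup>2 / 6)) / x ^ 4 \<le> Z + 2 * x\<^sup>2 * Z"
      using x by (simp add: field_simps)
  qed
  have ev: "eventually (\<lambda>x::real. 0 < x \<and> x < 1 / 2) (at_right 0)"
    using eventually_at_right_real[of 0 "1/2"] by simp
  have l1: "((\<lambda>x::real. 2 * (- ln (sin (pi * x) / (pi * x)) - x\<^sup>2 * (pi\<^sup>2 / 6)) / x ^ 4) \<longlongrightarrow> pi ^ 4 * (1 / 90)) (at_right 0)"
  proof -
    \<comment> \<open>Near \<open>0\<close> one has
      \<open>- ln (sin t / t) = t^2 / 6 + t^4 / 180 + ...\<close>; the substitution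
      \<open>t = pi * x\<close> then brings in the factor \<open>pi ^ 4\<close>.\<close>
    have "((\<lambda>t::real. 2 * (- ln (sin t / t) - t\<^sup>2 / 6) / t ^ 4) \<longlongrightarrow> 1 / 90) (at_right 0)"
      by real_asymp
    moreover have "filterlim (\<lambda>x. pi * x) (at_right 0) (at_right (0 :: real))"
    proof (rule filterlim_at_withinI)
      show "((\<lambda>x. pi * x) \<longlongrightarrow> 0) (at_right 0)" by (auto intro!: tendsto_eq_intros)
      show "\<forall>\<^sub>F x in at_right 0. pi * x \<in> {0<..} - {0}"
        by (rule eventually_mono[OF ev]) auto
    qed
    ultimately have "((\<lambda>x::real. 2 * (- ln (sin (pi * x) / (pi * x)) - (pi * x)\<^sup>2 / 6) / (pi * x) ^ 4) \<longlongrightarrow> 1 / 90) (at_right 0)"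
      by (rule filterlim_compose)
    from tendsto_mult_left[OF this, of "pi ^ 4"] show ?thesis
      by (simp add: power_mult_distrib mult.commute)
  qed
  have l2: "((\<lambda>x::real. Z + 2 * x\<^sup>2 * Z) \<longlongrightarrow> Z + 2 * 0\<^sup>2 * Z) (at_right 0)"
    by (intro tendsto_intros)
  \<comment> \<open>As \<open>x\<close> decreases to \<open>0\<close>, the two bounds squeeze
    \<open>Z\<close> onto the limit.\<close>
  have "Z \<le> pi ^ 4 * (1 / 90)"
    by (rule tendsto_lowerbound[OF l1]) (rule eventually_mono[OF ev], use bounds(1) in blast, simp)
  moreover have "pi ^ 4 * (1 / 90) \<le> Z + 2 * 0\<^sup>2 * Z"
    by (rule tendsto_le[OF _ l2 l1]) (simp, rule eventually_mono[OF ev], use bounds(2) in simp)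
  ultimately show ?thesis using Z by simp
qed

section \<open>The strip map\<close>

text \<open>The Riemann map of the disc onto the strip in \<^const>\<open>class_M\<close>, translated so that \<open>0\<close> is
  mapped to \<open>0\<close>.\<close>

definition strip_map :: "real \<Rightarrow> complex \<Rightarrow> complex" where
  "strip_map \<delta> z = (Ln (1 + z * cis \<delta>) - Ln (1 + z * cis (- \<delta>))) / (2 * \<i> * sin \<delta>)"

text \<open>At \<open>n = 0\<close> the quotient is \<open>0 / 0 = 0\<close>, as it should be.\<close>

definition strip_coeff :: "real \<Rightarrow> nat \<Rightarrow> real" where
  "strip_coeff \<delta> n = (- 1) ^ Suc n * sin (n * \<delta>) / (n * sin \<delta>)"

text \<open>Subtracting the two logarithm series leaves \<open>cis (n * \<delta>) - cis (- n *
  \<delta>) = 2 * \<i> * sin (n * \<delta>)\<close> in the coefficient of \<open>z ^ n\<close>, so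
  the division by \<open>2 * \<i> * sin \<delta>\<close> makes the coefficients real.\<close>

lemma strip_map_sums:
  assumes "norm z < 1" "sin \<delta> \<noteq> 0"
  shows "(\<lambda>n. complex_of_real (strip_coeff \<delta> n) * z ^ n) sums strip_map \<delta> z"
proof -
  have "(\<lambda>n. - ((- (z * cis t)) ^ n) / of_nat n) sums Ln (1 + z * cis t)" for t :: real
    using assms by (intro Ln_series') (simp add: norm_mult)
  hence "(\<lambda>n. (- ((- (z * cis \<delta>)) ^ n) / of_nat n - - ((- (z * cis (- \<delta>))) ^ n) / of_nat n) / (2 * \<i> * sin \<delta>))
           sums strip_map \<delta> z"
    unfolding strip_map_def by (intro sums_divide sums_diff)
  moreover have "(- ((- (z * cis \<delta>)) ^ n) / of_nat n - - ((- (z * cis (- \<delta>))) ^ n) / of_nat n) / (2 * \<i> * sin \<delta>)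
      = complex_of_real (strip_coeff \<delta> n) * z ^ n" for n
  proof -
    have pw: "(- (z * cis t)) ^ n = (- 1) ^ n * z ^ n * cis (n * t)" for t :: real
      by (simp only: power_minus[of "z * cis t"] power_mult_distrib Complex.DeMoivre mult.assoc)
    have cd: "cis (n * \<delta>) - cis (n * (- \<delta>)) = 2 * \<i> * sin (n * \<delta>)"
      by (simp add: complex_eq_iff)
    have "(- ((- (z * cis \<delta>)) ^ n) / of_nat n - - ((- (z * cis (- \<delta>))) ^ n) / of_nat n) =
        (- 1) ^ Suc n * z ^ n * (2 * \<i> * sin (n * \<delta>)) / of_nat n"
      unfolding pw by (simp only: flip: cd) (simp add: algebra_simps diff_divide_distrib)
    thus ?thesis using assms(2) by (simp add: strip_coeff_def)
  qed
  ultimately show ?thesis by simp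
qed

lemma strip_map_0 [simp]: "strip_map \<delta> 0 = 0"
  by (simp add: strip_map_def)

text \<open>This keeps the arguments of both logarithms in the right half-plane, where
  \<open>Ln\<close> is holomorphic and its imaginary part is below \<open>pi / 2\<close> in
  modulus.\<close>

lemma Re_one_plus_pos:
  fixes z :: complex
  assumes "norm z < 1"
  shows "Re (1 + z * cis t) > 0"
proof -
  have "\<bar>Re (z * cis t)\<bar> \<le> norm z" using abs_Re_le_cmod[of "z * cis t"] by (simp add: norm_mult)
  thus ?thesis using assms by (simp add: abs_le_iff)
qed

lemma strip_map_holomorphic: "strip_map \<delta> holomorphic_on ball 0 1"
proof -
  have "1 + z * cis t \<notin> \<real>\<^sub>\<le>\<^sub>0" if "z \<in> ball 0 1" for z t
    using Re_one_plus_pos[of z t] that by (auto simp: complex_nonpos_Reals_iff)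
  thus ?thesis unfolding strip_map_def[abs_def]
    by (cases "sin \<delta> = 0") (auto intro!: holomorphic_intros)
qed

lemma strip_map_has_fps_expansion:
  assumes "sin \<delta> \<noteq> 0"
  shows "strip_map \<delta> has_fps_expansion Abs_fps (\<lambda>n. complex_of_real (strip_coeff \<delta> n))"
proof (rule has_fps_expansionI)
  have "eventually (\<lambda>z::complex. z \<in> ball 0 1) (nhds 0)"
    by (intro eventually_nhds_in_open) auto
  thus "\<forall>\<^sub>F u in nhds 0. (\<lambda>n. fps_nth (Abs_fps (\<lambda>n. complex_of_real (strip_coeff \<delta> n))) n * u ^ n) sums strip_map \<delta> u"
    by eventually_elim (use strip_map_sums assms in auto)
qed

text \<open>The real part is \<open>\<theta> / (2 * sin \<delta>)\<close>, where
  \<open>\<theta>\<close> is the difference of the arguments of \<open>a\<close> and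
  \<open>b\<close>. Computing the imaginary part of \<open>a * cnj b * cis (- \<delta>)\<close> in
  polar and in Cartesian form shows that \<open>sin (\<theta> - \<delta>)\<close> has the sign of
  \<open>sin \<delta> * (|z|^2 - 1)\<close>, so it is negative. Together with
  \<open>|\<theta>| < pi\<close> this puts \<open>\<theta>\<close> between
  \<open>\<delta> - pi\<close> and \<open>\<delta>\<close>.\<close>

lemma strip_map_Re_bounds:
  assumes \<delta>: "0 < \<delta>" "\<delta> < pi" and z: "norm z < 1"
  shows "(\<delta> - pi) / (2 * sin \<delta>) < Re (strip_map \<delta> z)" and "Re (strip_map \<delta> z) < \<delta> / (2 * sin \<delta>)"
proof -
  have s: "sin \<delta> > 0" using \<delta> by (intro sin_gt_zero) auto
  define a b where "a = 1 + z * cis \<delta>" and "b = 1 + z * cis (- \<delta>)"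
  define \<theta> where "\<theta> = Im (Ln a) - Im (Ln b)"
  have ab: "Re a > 0" "Re b > 0" unfolding a_def b_def by (intro Re_one_plus_pos z)+
  hence ab0: "a \<noteq> 0" "b \<noteq> 0" by auto
  have "\<bar>Im (Ln a)\<bar> < pi / 2" "\<bar>Im (Ln b)\<bar> < pi / 2" using ab Re_Ln_pos_lt_imp by blast+
  hence \<theta>: "\<bar>\<theta>\<bar> < pi" by (simp add: \<theta>_def)
  have Re: "Re (strip_map \<delta> z) = \<theta> / (2 * sin \<delta>)"
    using s by (simp add: strip_map_def a_def b_def \<theta>_def Re_divide power2_eq_square field_simps)
  have "a = of_real (norm a) * cis (Im (Ln a))" "b = of_real (norm b) * cis (Im (Ln b))"
    using ab0 by (metis Arg_eq_Im_Ln rcis_cmod_Arg rcis_def)+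
  hence "a * cnj b * cis (- \<delta>) = (of_real (norm a) * cis (Im (Ln a))) * cnj (of_real (norm b) * cis (Im (Ln b))) * cis (- \<delta>)"
    by simp
  also have "\<dots> = of_real (norm a * norm b) * cis (\<theta> - \<delta>)"
    by (simp add: cis_cnj cis_mult \<theta>_def algebra_simps)
  finally have "Im (a * cnj b * cis (- \<delta>)) = norm a * norm b * sin (\<theta> - \<delta>)" by simp
  moreover have "Im (a * cnj b * cis (- \<delta>)) = sin \<delta> * ((norm z)\<^sup>2 - 1)"
  proof -
    have "cnj b = 1 + cnj z * cis \<delta>" by (simp add: b_def cis_cnj)
    hence "a * cnj b * cis (- \<delta>) = cis (- \<delta>) + (z + cnj z) * (cis \<delta> * cis (- \<delta>)) + z * cnj z * cis \<delta> * (cis \<delta> * cis (- \<delta>))"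
      by (simp add: a_def algebra_simps)
    also have "\<dots> = cis (- \<delta>) + of_real (2 * Re z) + of_real ((norm z)\<^sup>2) * cis \<delta>"
      unfolding complex_norm_square by (simp add: cis_mult complex_add_cnj)
    finally show ?thesis by (simp add: algebra_simps)
  qed
  moreover have "sin \<delta> * ((norm z)\<^sup>2 - 1) < 0"
    using s z by (intro mult_pos_neg) (simp_all add: abs_square_less_1)
  ultimately have "norm a * norm b * sin (\<theta> - \<delta>) < 0" by simp
  hence sn: "sin (\<theta> - \<delta>) < 0" using ab0
    by (metis mult_nonneg_nonneg norm_ge_zero not_le)
  have "\<theta> < \<delta>"
    using sn \<theta> \<delta> sin_ge_zero[of "\<theta> - \<delta>"] by (auto simp: not_le abs_less_iff intro: ccontr)
  moreover have "\<delta> - pi < \<theta>"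
  \<comment> \<open>Otherwise \<open>\<theta> - \<delta> + 2 * pi\<close> would lie between
    \<open>0\<close> and \<open>pi\<close>, where the sine is nonnegative.\<close>
  proof (rule ccontr)
    assume "\<not> \<delta> - pi < \<theta>"
    hence "sin (\<theta> - \<delta> + 2 * pi) \<ge> 0" using \<theta> \<delta> by (intro sin_ge_zero) (auto simp: abs_less_iff)
    thus False using sn by simp
  qed
  ultimately show "(\<delta> - pi) / (2 * sin \<delta>) < Re (strip_map \<delta> z)" "Re (strip_map \<delta> z) < \<delta> / (2 * sin \<delta>)"
    unfolding Re using s by (auto intro: divide_strict_right_mono)
qed

text \<open>The strip map is inverted explicitly. Exponentiating
  \<open>p = strip_map \<delta> \<omega>\<close> gives \<open>u = (1 + \<omega> * cis \<delta>) / (1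
  + \<omega> * cis (- \<delta>))\<close> with \<open>u = exp (2 * \<i> * sin \<delta> * p)\<close>,
  and solving for \<open>\<omega>\<close> yields the quotient defined below.\<close>

lemma strip_map_subordination:
  assumes \<delta>: "0 < \<delta>" "\<delta> < pi" and p: "p holomorphic_on ball 0 1" "p 0 = 0"
    and bd: "\<And>z. norm z < 1 \<Longrightarrow> (\<delta> - pi) / (2 * sin \<delta>) < Re (p z) \<and> Re (p z) < \<delta> / (2 * sin \<delta>)"
  obtains \<omega> where "\<omega> holomorphic_on ball 0 1" "\<omega> 0 = 0" "\<And>z. norm z < 1 \<Longrightarrow> norm (\<omega> z) < 1"
    "\<And>z. norm z < 1 \<Longrightarrow> p z = strip_map \<delta> (\<omega> z)"
proof -
  have s: "sin \<delta> > 0" using \<delta> by (intro sin_gt_zero) auto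
  define u where "u = (\<lambda>z. exp (2 * \<i> * sin \<delta> * p z))"
  define \<omega> where "\<omega> = (\<lambda>z. (u z - 1) / (cis \<delta> - u z * cis (- \<delta>)))"
  \<comment> \<open>The right-hand side is the distance from \<open>u z\<close> to
    \<open>cis (2 * \<delta>)\<close>. The strip condition places the argument of \<open>u z\<close>
    between \<open>\<delta> - pi\<close> and \<open>\<delta>\<close>, that is, \<open>u z\<close> in
    the half-plane of points closer to \<open>1\<close> than to
    \<open>cis (2 * \<delta>)\<close>.\<close>
  have lt: "norm (u z - 1) < norm (cis \<delta> - u z * cis (- \<delta>))" if z: "norm z < 1" for z
  proof -
    define \<theta> where "\<theta> = 2 * sin \<delta> * Re (p z)"
    define \<rho> where "\<rho> = exp (- 2 * sin \<delta> * Im (p z))"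
    have \<rho>: "\<rho> > 0" by (simp add: \<rho>_def)
    have th: "\<delta> - pi < \<theta>" "\<theta> < \<delta>" using bd[OF z] s by (simp_all add: \<theta>_def field_simps)
    have u: "u z = of_real \<rho> * cis \<theta>"
      by (simp add: u_def \<rho>_def \<theta>_def exp_eq_polar)
    have "(norm (cis \<delta> - u z * cis (- \<delta>)))\<^sup>2 = (norm (cis \<delta> - of_real \<rho> * cis (\<theta> - \<delta>)))\<^sup>2"
      by (simp add: u mult.assoc cis_mult)
    also have "\<dots> = 1 + \<rho>\<^sup>2 - 2 * \<rho> * cos (\<delta> - (\<theta> - \<delta>))"
    proof -
      have "(norm (cis \<delta> - of_real \<rho> * cis (\<theta> - \<delta>)))\<^sup>2 =
         ((sin \<delta>)\<^sup>2 + (cos \<delta>)\<^sup>2) + \<rho>\<^sup>2 * ((sin (\<theta> - \<delta>))\<^sup>2 + (cos (\<theta> - \<delta>))\<^sup>2) 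
          - 2 * \<rho> * (cos \<delta> * cos (\<theta> - \<delta>) + sin \<delta> * sin (\<theta> - \<delta>))"
      proof -
        have "(c - \<rho> * C)\<^sup>2 + (d - \<rho> * S)\<^sup>2 = (d\<^sup>2 + c\<^sup>2) + \<rho>\<^sup>2 * (S\<^sup>2 + C\<^sup>2) - 2 * \<rho> * (c * C + d * S)" for c d C S :: real
          by algebra
        thus ?thesis unfolding cmod_power2 by (simp del: sin_cos_squared_add sin_cos_squared_add2)
      qed
      thus ?thesis unfolding sin_cos_squared_add cos_diff[symmetric] by simp
    qed
    finally have 1: "(norm (cis \<delta> - u z * cis (- \<delta>)))\<^sup>2 = 1 + \<rho>\<^sup>2 - 2 * \<rho> * cos (\<delta> - (\<theta> - \<delta>))" .
    have 2: "(norm (u z - 1))\<^sup>2 = 1 + \<rho>\<^sup>2 - 2 * \<rho> * cos \<theta>"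
    proof -
      have "(norm (u z - 1))\<^sup>2 = \<rho>\<^sup>2 * ((sin \<theta>)\<^sup>2 + (cos \<theta>)\<^sup>2) + 1 - 2 * \<rho> * cos \<theta>"
      proof -
        have "(\<rho> * c - 1)\<^sup>2 + (\<rho> * d)\<^sup>2 = \<rho>\<^sup>2 * (d\<^sup>2 + c\<^sup>2) + 1 - 2 * \<rho> * c" for c d :: real
          by algebra
        thus ?thesis unfolding cmod_power2 u by (simp del: sin_cos_squared_add sin_cos_squared_add2)
      qed
      thus ?thesis by simp
    qed
    have "cos \<theta> - cos (\<delta> - (\<theta> - \<delta>)) = 2 * sin \<delta> * sin (\<delta> - \<theta>)"
    proof -
      have "cos (\<delta> - t) - cos (\<delta> + t) = 2 * sin \<delta> * sin t" for t
        by (simp add: cos_add cos_diff)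
      from this[of "\<delta> - \<theta>"] show ?thesis by (simp add: algebra_simps)
    qed
    moreover have "sin (\<delta> - \<theta>) > 0" using th by (intro sin_gt_zero) auto
    ultimately have "\<rho> * cos \<theta> > \<rho> * cos (\<delta> - (\<theta> - \<delta>))" using s \<rho> by (smt (verit) mult_pos_pos mult_strict_left_mono)
    hence "(norm (u z - 1))\<^sup>2 < (norm (cis \<delta> - u z * cis (- \<delta>)))\<^sup>2" unfolding 1 2 by simp
    thus ?thesis by (rule power2_less_imp_less) simp
  qed
  have nz: "cis \<delta> - u z * cis (- \<delta>) \<noteq> 0" if "norm z < 1" for z
    using lt[OF that] by auto
  have hol\<omega>: "\<omega> holomorphic_on ball 0 1"
    unfolding \<omega>_def u_def using p(1) nz[unfolded u_def] by (intro holomorphic_intros) auto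
  have \<omega>0: "\<omega> 0 = 0" by (simp add: \<omega>_def u_def p(2))
  have \<omega>1: "norm (\<omega> z) < 1" if "norm z < 1" for z
    using lt[OF that] by (simp add: \<omega>_def norm_divide divide_less_eq)
  \<comment> \<open>The exponentials of both sides, scaled by
    \<open>2 * \<i> * sin \<delta>\<close>, agree by the choice of \<open>\<omega>\<close>. The
    logarithms themselves agree because both are holomorphic on the disc and vanish at
    \<open>0\<close>.\<close>
  have "p z = strip_map \<delta> (\<omega> z)" if z: "norm z < 1" for z
  proof -
    have ne: "1 + \<omega> z * cis t \<notin> \<real>\<^sub>\<le>\<^sub>0" if "z \<in> ball 0 1" for z t
      using Re_one_plus_pos[OF \<omega>1, of z t] that by (auto simp: complex_nonpos_Reals_iff)
    have ne0: "1 + \<omega> z * cis t \<noteq> 0" if "z \<in> ball 0 1" for z t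
      using ne[OF that, of t] by auto
    have "u z * (1 + \<omega> z * cis (- \<delta>)) = 1 + \<omega> z * cis \<delta>" if z: "norm z < 1" for z
    proof -
      have c: "cis \<delta> * cis (- \<delta>) = 1" by (simp add: cis_mult)
      show ?thesis using nz[OF z] c unfolding \<omega>_def by (simp add: field_simps)
    qed
    hence quot: "u z = (1 + \<omega> z * cis \<delta>) / (1 + \<omega> z * cis (- \<delta>))" if "norm z < 1" for z
      using that ne0[of z] by (simp add: eq_divide_eq)
    \<comment> \<open>Uniqueness of logarithms is available only for quotients \<open>f z / z\<close>, hence this artificial \<open>f\<close>.\<close>
    define f where "f = (\<lambda>z. z * u z)"
    have zq: "z_quot f z = u z" if "norm z < 1" for z
      by (simp add: z_quot_def f_def u_def p(2))
    have L: "is_log_quot f (\<lambda>z. 2 * \<i> * sin \<delta> * p z)"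
      using p zq by (auto simp: is_log_quot_def u_def intro!: holomorphic_intros)
    have M: "is_log_quot f (\<lambda>z. Ln (1 + \<omega> z * cis \<delta>) - Ln (1 + \<omega> z * cis (- \<delta>)))"
      unfolding is_log_quot_def
    proof (intro conjI ballI)
      show "(\<lambda>z. Ln (1 + \<omega> z * cis \<delta>) - Ln (1 + \<omega> z * cis (- \<delta>))) holomorphic_on ball 0 1"
        using ne by (intro holomorphic_intros hol\<omega>) auto
      fix z :: complex assume z: "z \<in> ball 0 1"
      show "exp (Ln (1 + \<omega> z * cis \<delta>) - Ln (1 + \<omega> z * cis (- \<delta>))) = z_quot f z"
        using z ne0[OF z] quot zq by (simp add: exp_diff)
    qed (simp add: \<omega>0)
    have "2 * \<i> * sin \<delta> * p z = Ln (1 + \<omega> z * cis \<delta>) - Ln (1 + \<omega> z * cis (- \<delta>))"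
      using is_log_quot_unique[OF L M, of z] z by simp
    thus ?thesis unfolding strip_map_def using s by (simp add: field_simps)
  qed
  with hol\<omega> \<omega>0 \<omega>1 show ?thesis by (rule that)
qed

section \<open>Logarithmic coefficients\<close>

text \<open>Dividing \<open>deriv f z\<close> by \<open>z_quot f z\<close> cancels the zero of
  \<open>f\<close> at the origin and gives the prescribed value \<open>1\<close> there.\<close>

lemma log_deriv_quot_minus_one_holomorphic:
  assumes "f \<in> class_A" and nz: "\<And>z. z \<in> ball 0 1 - {0} \<Longrightarrow> f z \<noteq> 0"
  shows "(\<lambda>z. log_deriv_quot f z - 1) holomorphic_on ball 0 1"
proof -
  have f: "f holomorphic_on ball 0 1" "f 0 = 0" "deriv f 0 = 1"
    using assms(1) by (auto simp: class_A_def)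
  have zq: "z_quot f holomorphic_on ball 0 1"
    by (rule pole_theorem_open_0[where g = f and a = 0]) (use f in \<open>auto simp: z_quot_def\<close>)
  have "(\<lambda>z. deriv f z / z_quot f z - 1) holomorphic_on ball 0 1"
    by (intro holomorphic_intros zq f(1)) (use nz in \<open>auto simp: z_quot_def\<close>)
  moreover have "deriv f z / z_quot f z - 1 = log_deriv_quot f z - 1" for z
    by (simp add: z_quot_def log_deriv_quot_def f(3))
  ultimately show ?thesis by simp
qed

text \<open>Away from the origin this is the logarithmic derivative of
  \<open>f z = z * exp (L z)\<close>.\<close>

lemma is_log_quot_deriv:
  assumes "f \<in> class_A" and nz: "\<And>z. z \<in> ball 0 1 - {0} \<Longrightarrow> f z \<noteq> 0"
    and L: "is_log_quot f L" and z: "z \<in> ball 0 1"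
  shows "z * deriv L z = log_deriv_quot f z - 1"
proof (cases "z = 0")
  case False
  have f: "f holomorphic_on ball 0 1" using assms(1) by (auto simp: class_A_def)
  have Lh: "L holomorphic_on ball 0 1" and Le: "\<And>z. z \<in> ball 0 1 \<Longrightarrow> exp (L z) = z_quot f z"
    using L by (auto simp: is_log_quot_def)
  have eq: "w * exp (L w) = f w" if "w \<in> ball 0 1" for w
    using Le[OF that] assms(1) by (auto simp: z_quot_def class_A_def)
  have dL: "(L has_field_derivative deriv L z) (at z)"
    using Lh z by (simp add: holomorphic_derivI)
  have "((\<lambda>w. w * exp (L w)) has_field_derivative (exp (L z) + z * (exp (L z) * deriv L z))) (at z)"
    using dL by (auto intro!: derivative_eq_intros)
  hence "(f has_field_derivative (exp (L z) + z * (exp (L z) * deriv L z))) (at z)"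
    by (rule has_field_derivative_transform_within_open[where S = "ball 0 1"]) (use z eq in auto)
  hence "deriv f z = exp (L z) * (1 + z * deriv L z)"
    by (simp add: DERIV_imp_deriv algebra_simps)
  moreover have "f z = z * exp (L z)" using eq[OF z] by simp
  ultimately show ?thesis using False by (simp add: log_deriv_quot_def)
qed (simp add: log_deriv_quot_def)

lemma log_coeff_is_log_coeffs:
  assumes "f \<in> class_A" and "\<And>z. z \<in> ball 0 1 - {0} \<Longrightarrow> f z \<noteq> 0"
  shows "is_log_coeffs f (log_coeff f)"
  unfolding log_coeff_def using is_log_coeffs_ex1[OF assms] by (rule theI')

text \<open>The operator \<open>z * d/dz\<close> turns the logarithm of \<open>f z / z\<close> into
  \<open>z f'(z) / f(z) - 1\<close> and multiplies the coefficient \<open>2 * log_coeff f n\<close>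
  by \<open>n\<close>.\<close>

lemma log_deriv_quot_has_fps_expansion:
  assumes f: "f \<in> class_A" "\<And>z. z \<in> ball 0 1 - {0} \<Longrightarrow> f z \<noteq> 0"
  shows "(\<lambda>z. log_deriv_quot f z - 1) has_fps_expansion Abs_fps (\<lambda>n. 2 * of_nat n * log_coeff f n)"
proof -
  let ?\<gamma> = "log_coeff f"
  obtain L where L: "is_log_quot f L" and s: "\<And>z. z \<in> ball 0 1 \<Longrightarrow> (\<lambda>n. 2 * ?\<gamma> (Suc n) * z ^ Suc n) sums L z"
    and g0: "?\<gamma> 0 = 0"
    using log_coeff_is_log_coeffs[OF f] unfolding is_log_coeffs_def by blast
  have near: "eventually (\<lambda>z::complex. z \<in> ball 0 1) (nhds 0)"
    by (intro eventually_nhds_in_open) auto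
  have s': "(\<lambda>n. 2 * ?\<gamma> n * z ^ n) sums L z" if "z \<in> ball 0 1" for z
    using s[OF that] by (subst (asm) sums_Suc_iff) (simp add: g0)
  have "L has_fps_expansion Abs_fps (\<lambda>n. 2 * ?\<gamma> n)"
    by (rule has_fps_expansionI, rule eventually_mono[OF near]) (use s' in simp)
  hence "(\<lambda>z. z * deriv L z) has_fps_expansion fps_X * fps_deriv (Abs_fps (\<lambda>n. 2 * ?\<gamma> n))"
    by (intro fps_expansion_intros)
  also have "fps_X * fps_deriv (Abs_fps (\<lambda>n. 2 * ?\<gamma> n)) = Abs_fps (\<lambda>n. 2 * of_nat n * ?\<gamma> n)"
    by (auto simp: fps_eq_iff)
  finally show ?thesis
    by (subst has_fps_expansion_cong[OF _ refl, where g = "\<lambda>z. z * deriv L z"])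
       (rule eventually_mono[OF near], use is_log_quot_deriv[OF f L] in simp)
qed

text \<open>With \<open>m = Suc n\<close>, each summand is
  \<open>(sin (m * \<delta>))^2 / (4 * m^4 * (sin \<delta>)^2)\<close>. The identity
  \<open>4 * (sin t)^2 = 2 - 2 * cos (2 * t)\<close> splits it into an inverse fourth power and the
  real parts of two conjugate terms of \<open>Li4\<close>.\<close>

lemma strip_coeff_weighted_sums:
  assumes "sin \<delta> \<noteq> 0"
  shows "(\<lambda>n. 1 / (4 * real (Suc n) ^ 2) * (strip_coeff \<delta> (Suc n))\<^sup>2) sums
           (1 / (16 * (sin \<delta>)\<^sup>2) *
              Re (complex_of_real (pi ^ 4 / 45) - Li4 (exp (- 2 * \<i> * complex_of_real \<delta>))
                    - Li4 (exp (2 * \<i> * complex_of_real \<delta>))))"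
proof -
  have Li4: "(\<lambda>n. z ^ Suc n / of_nat (Suc n) ^ 4) sums Li4 z" if "norm z \<le> 1" for z
    unfolding Li4_def
  proof (rule summable_sums, rule summable_comparison_test')
    show "summable (\<lambda>n. 1 / real (Suc n) ^ 4)" using inverse_fourth_powers_sums by (rule sums_summable)
    show "norm (z ^ Suc n / of_nat (Suc n) ^ 4) \<le> 1 / real (Suc n) ^ 4" if "n \<ge> 0" for n
      using power_le_one[OF norm_ge_zero \<open>norm z \<le> 1\<close>, of "Suc n"]
      by (simp add: norm_divide norm_power norm_mult divide_right_mono del: of_nat_Suc)
  qed
  have "(\<lambda>n. complex_of_real (2 * (1 / real (Suc n) ^ 4)) - exp (- 2 * \<i> * complex_of_real \<delta>) ^ Suc n / of_nat (Suc n) ^ 4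
         - exp (2 * \<i> * complex_of_real \<delta>) ^ Suc n / of_nat (Suc n) ^ 4) sums
      (complex_of_real (2 * (pi ^ 4 / 90)) - Li4 (exp (- 2 * \<i> * complex_of_real \<delta>)) - Li4 (exp (2 * \<i> * complex_of_real \<delta>)))"
    by (intro sums_diff Li4 sums_of_real sums_mult inverse_fourth_powers_sums) simp_all
  from sums_mult[OF sums_Re[OF this], of "1 / (16 * (sin \<delta>)\<^sup>2)"] 
  have "(\<lambda>n. 1 / (16 * (sin \<delta>)\<^sup>2) * Re (complex_of_real (2 * (1 / real (Suc n) ^ 4)) - exp (- 2 * \<i> * complex_of_real \<delta>) ^ Suc n / of_nat (Suc n) ^ 4
         - exp (2 * \<i> * complex_of_real \<delta>) ^ Suc n / of_nat (Suc n) ^ 4)) sums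
         (1 / (16 * (sin \<delta>)\<^sup>2) *
              Re (complex_of_real (pi ^ 4 / 45) - Li4 (exp (- 2 * \<i> * complex_of_real \<delta>))
                    - Li4 (exp (2 * \<i> * complex_of_real \<delta>))))"
    by simp
  moreover have "1 / (16 * (sin \<delta>)\<^sup>2) * Re (complex_of_real (2 * (1 / real (Suc n) ^ 4)) - exp (- 2 * \<i> * complex_of_real \<delta>) ^ Suc n / of_nat (Suc n) ^ 4
         - exp (2 * \<i> * complex_of_real \<delta>) ^ Suc n / of_nat (Suc n) ^ 4) = 1 / (4 * real (Suc n) ^ 2) * (strip_coeff \<delta> (Suc n))\<^sup>2" for n
  proof -
    define m where "m = real (Suc n)"
    have m: "m \<noteq> 0" by (simp add: m_def)
    have e: "exp (2 * \<i> * complex_of_real \<delta>) = cis (2 * \<delta>)" "exp (- 2 * \<i> * complex_of_real \<delta>) = cis (- 2 * \<delta>)"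
      by (simp_all add: cis_conv_exp mult_ac)
    have r: "Re (cis t ^ Suc n / of_nat (Suc n) ^ 4) = cos (m * t) / m ^ 4" for t
    proof -
      have "cis t ^ Suc n / of_nat (Suc n) ^ 4 = cis (m * t) / complex_of_real (m ^ 4)"
        unfolding Complex.DeMoivre m_def by (simp only: of_real_power of_real_of_nat_eq)
      thus ?thesis by (simp only: Re_divide_of_real cis.sel)
    qed
    have "Re (complex_of_real (2 * (1 / real (Suc n) ^ 4)) - exp (- 2 * \<i> * complex_of_real \<delta>) ^ Suc n / of_nat (Suc n) ^ 4
         - exp (2 * \<i> * complex_of_real \<delta>) ^ Suc n / of_nat (Suc n) ^ 4)
       = 2 * (1 / m ^ 4) - cos (m * (- 2 * \<delta>)) / m ^ 4 - cos (m * (2 * \<delta>)) / m ^ 4"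
      by (simp only: e r minus_complex.sel Re_complex_of_real m_def)
    also have "\<dots> = (2 - 2 * cos (2 * (m * \<delta>))) / m ^ 4"
      by (simp add: diff_divide_distrib mult_ac)
    also have "\<dots> = 4 * (sin (m * \<delta>))\<^sup>2 / m ^ 4"
      by (simp only: cos_double_sin) simp
    finally have R: "Re (complex_of_real (2 * (1 / real (Suc n) ^ 4)) - exp (- 2 * \<i> * complex_of_real \<delta>) ^ Suc n / of_nat (Suc n) ^ 4
         - exp (2 * \<i> * complex_of_real \<delta>) ^ Suc n / of_nat (Suc n) ^ 4) = 4 * (sin (m * \<delta>))\<^sup>2 / m ^ 4" .
    have S: "(strip_coeff \<delta> (Suc n))\<^sup>2 = (sin (m * \<delta>))\<^sup>2 / (m\<^sup>2 * (sin \<delta>)\<^sup>2)"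
      unfolding strip_coeff_def m_def[symmetric] by (simp add: power_divide power_mult_distrib power_even_eq flip: power_mult)
    show ?thesis unfolding R S unfolding m_def[symmetric] using m assms
      by (simp add: field_simps flip: power_add)
  qed
  ultimately show ?thesis by simp
qed

text \<open>Solving \<open>z f'(z) / f(z) = 1 + strip_map \<delta> z\<close> gives
  \<open>f z = z * exp (L z)\<close>, where \<open>L\<close> is the primitive of
  \<open>strip_map \<delta> z / z\<close> with \<open>L 0 = 0\<close>; this normalization makes
  \<open>deriv f 0 = 1\<close>.\<close>

lemma strip_map_extremal:
  assumes \<delta>: "0 < \<delta>" "\<delta> < pi"
  obtains f where "f \<in> class_M \<delta>" "\<And>z. z \<in> ball 0 1 \<Longrightarrow> log_deriv_quot f z = 1 + strip_map \<delta> z"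
proof -
  obtain h where h: "h holomorphic_on ball 0 1" "\<And>z. norm z < 1 \<Longrightarrow> strip_map \<delta> z = z * h z"
    using Schwarz3[OF strip_map_holomorphic strip_map_0] by blast
  obtain g where g: "\<And>z. z \<in> ball 0 1 \<Longrightarrow> (g has_field_derivative h z) (at z within ball 0 1)"
    using holomorphic_convex_primitive'[OF convex_ball open_ball h(1)] by blast
  define L where "L = (\<lambda>z. g z - g 0)"
  define f where "f = (\<lambda>z. z * exp (L z))"
  have dL: "(L has_field_derivative h z) (at z)" if "z \<in> ball 0 1" for z
    using g[OF that] that by (auto simp: L_def at_within_open[of z "ball 0 1"] intro!: derivative_eq_intros)
  have df: "(f has_field_derivative exp (L z) * (1 + z * h z)) (at z)" if "z \<in> ball 0 1" for z
    unfolding f_def using dL[OF that] by (auto intro!: derivative_eq_intros simp: algebra_simps)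
  hence hol: "f holomorphic_on ball 0 1"
    by (meson field_differentiable_def holomorphic_onI field_differentiable_at_within)
  have dv: "deriv f z = exp (L z) * (1 + z * h z)" if "z \<in> ball 0 1" for z
    using df[OF that] by (rule DERIV_imp_deriv)
  have A: "f \<in> class_A" using hol dv[of 0] by (simp add: class_A_def f_def L_def)
  have q: "log_deriv_quot f z = 1 + strip_map \<delta> z" if "z \<in> ball 0 1" for z
    using dv[OF that] h(2)[of z] that by (simp add: log_deriv_quot_def f_def)
  have "f \<in> class_M \<delta>"
    using A q strip_map_Re_bounds[OF \<delta>] by (auto simp: class_M_def f_def)
  thus ?thesis using q by (rule that)
qed

section \<open>The sharp bound for the logarithmic coefficients\<close>

theorem theorem2p5:
  fixes \<delta> :: real
  assumes "pi / 2 \<le> \<delta>" and "\<delta> < pi"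
  shows "(\<forall>f\<in>class_M \<delta>.
            summable (\<lambda>n. (cmod (log_coeff f (Suc n)))\<^sup>2) \<and>
            (\<Sum>n. (cmod (log_coeff f (Suc n)))\<^sup>2) \<le>
              1 / (16 * (sin \<delta>)\<^sup>2) *
              Re (complex_of_real (pi ^ 4 / 45) - Li4 (exp (- 2 * \<i> * complex_of_real \<delta>))
                    - Li4 (exp (2 * \<i> * complex_of_real \<delta>)))) \<and>
         (\<exists>f\<in>class_M \<delta>.
            (\<lambda>n. (cmod (log_coeff f (Suc n)))\<^sup>2) sums
              (1 / (16 * (sin \<delta>)\<^sup>2) *
              Re (complex_of_real (pi ^ 4 / 45) - Li4 (exp (- 2 * \<i> * complex_of_real \<delta>))
                    - Li4 (exp (2 * \<i> * complex_of_real \<delta>)))))"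
proof -
  have \<delta>: "0 < \<delta>" "\<delta> < pi" using assms pi_gt_zero by linarith+
  have s: "sin \<delta> > 0" using \<delta> by (intro sin_gt_zero)
  hence s0: "sin \<delta> \<noteq> 0" by simp
  \<comment> \<open>The weight at index \<open>n\<close> belongs to the coefficient of
    \<open>z ^ Suc n\<close>: it undoes the factor \<open>2 * Suc n\<close> that differentiation
    introduces, after squaring.\<close>
  define w where "w = (\<lambda>n. 1 / (4 * real (Suc n) ^ 2))"
  let ?B = "1 / (16 * (sin \<delta>)\<^sup>2) *
              Re (complex_of_real (pi ^ 4 / 45) - Li4 (exp (- 2 * \<i> * complex_of_real \<delta>))
                    - Li4 (exp (2 * \<i> * complex_of_real \<delta>)))"
  have B: "(\<lambda>n. w n * (strip_coeff \<delta> (Suc n))\<^sup>2) sums ?B"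
    using strip_coeff_weighted_sums[OF s0] by (simp only: w_def)
  have coeff: "(cmod (log_coeff f (Suc n)))\<^sup>2 = w n * (norm (2 * of_nat (Suc n) * log_coeff f (Suc n)))\<^sup>2" for f n
    by (simp add: w_def norm_mult power_mult_distrib del: of_nat_Suc)
  have upper: "summable (\<lambda>n. (cmod (log_coeff f (Suc n)))\<^sup>2) \<and> (\<Sum>n. (cmod (log_coeff f (Suc n)))\<^sup>2) \<le> ?B"
    if f: "f \<in> class_M \<delta>" for f
  proof -
    have fA: "f \<in> class_A" and nz: "\<And>z. z \<in> ball 0 1 - {0} \<Longrightarrow> f z \<noteq> 0"
      using f by (auto simp: class_M_def)
    define p where "p = (\<lambda>z. log_deriv_quot f z - 1)"
    have ph: "p holomorphic_on ball 0 1"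
      unfolding p_def using fA nz by (rule log_deriv_quot_minus_one_holomorphic)
    have p0: "p 0 = 0" by (simp add: p_def log_deriv_quot_def)
    have bd: "(\<delta> - pi) / (2 * sin \<delta>) < Re (p z) \<and> Re (p z) < \<delta> / (2 * sin \<delta>)" if "norm z < 1" for z
      using f that by (force simp: class_M_def p_def)
    obtain \<omega> where \<omega>: "\<omega> holomorphic_on ball 0 1" "\<omega> 0 = 0" "\<And>z. norm z < 1 \<Longrightarrow> norm (\<omega> z) < 1"
      "\<And>z. norm z < 1 \<Longrightarrow> p z = strip_map \<delta> (\<omega> z)"
      using strip_map_subordination[OF \<delta> ph p0 bd] by blast
    have pE: "p has_fps_expansion Abs_fps (\<lambda>n. 2 * of_nat n * log_coeff f n)"
      unfolding p_def using fA nz by (rule log_deriv_quot_has_fps_expansion)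
    have rog: "(\<Sum>k\<le>n. (norm (2 * of_nat k * log_coeff f k))\<^sup>2) \<le> (\<Sum>k\<le>n. (strip_coeff \<delta> k)\<^sup>2)" for n
      using rogosinski_subordination[OF strip_map_has_fps_expansion[OF s0] \<omega>(1-3) pE \<omega>(4), of n] by simp
    \<comment> \<open>The terms of index \<open>0\<close> are dropped; they vanish on both sides,
      \<open>strip_coeff \<delta> 0\<close> being \<open>0\<close> by the convention for division by
      zero.\<close>
    have rog': "(\<Sum>k\<le>n. (norm (2 * of_nat (Suc k) * log_coeff f (Suc k)))\<^sup>2) \<le> (\<Sum>k\<le>n. (strip_coeff \<delta> (Suc k))\<^sup>2)" for n
      using rog[of "Suc n"] by (simp only: sum.atMost_Suc_shift) (simp add: strip_coeff_def)
    have "(\<Sum>k\<le>n. w k * (norm (2 * of_nat (Suc k) * log_coeff f (Suc k)))\<^sup>2) \<le> (\<Sum>k\<le>n. w k * (strip_coeff \<delta> (Suc k))\<^sup>2)" for n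
    proof (rule weighted_sum_le_of_partial_sums_le[OF rog'])
      show "decseq w" unfolding w_def decseq_Suc_iff
        by (auto intro!: divide_left_mono mult_left_mono power_mono)
    qed (simp add: w_def)
    also have "(\<Sum>k\<le>n. w k * (strip_coeff \<delta> (Suc k))\<^sup>2) \<le> ?B" for n
      unfolding sums_unique[OF B] by (rule sum_le_suminf[OF sums_summable[OF B]]) (auto simp: w_def)
    finally have le: "(\<Sum>k\<le>n. (cmod (log_coeff f (Suc k)))\<^sup>2) \<le> ?B" for n
      by (simp only: coeff)
    have sm: "summable (\<lambda>n. (cmod (log_coeff f (Suc n)))\<^sup>2)"
      by (rule bounded_imp_summable[OF _ le]) simp
    thus ?thesis
      using LIMSEQ_le_const2[OF summable_LIMSEQ'[OF sm]] le by blast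
  qed
  \<comment> \<open>For sharpness the subordination is by the identity:
    \<open>log_deriv_quot f - 1\<close> is the strip map itself, so each
    \<open>2 * n * log_coeff f n\<close> equals \<open>strip_coeff \<delta> n\<close> by uniqueness
    of power series.\<close>
  obtain f where f: "f \<in> class_M \<delta>" "\<And>z. z \<in> ball 0 1 \<Longrightarrow> log_deriv_quot f z = 1 + strip_map \<delta> z"
    using strip_map_extremal[OF \<delta>] by blast
  have "(\<lambda>z. log_deriv_quot f z - 1) has_fps_expansion Abs_fps (\<lambda>n. 2 * of_nat n * log_coeff f n)"
    using f(1) by (intro log_deriv_quot_has_fps_expansion) (auto simp: class_M_def)
  moreover have "eventually (\<lambda>z. log_deriv_quot f z - 1 = strip_map \<delta> z) (nhds 0)"
  proof -
    have "eventually (\<lambda>z::complex. z \<in> ball 0 1) (nhds 0)"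
      by (intro eventually_nhds_in_open) auto
    thus ?thesis by eventually_elim (simp add: f(2))
  qed
  ultimately have "strip_map \<delta> has_fps_expansion Abs_fps (\<lambda>n. 2 * of_nat n * log_coeff f n)"
    by (rule has_fps_expansion_cong[OF _ refl, THEN iffD1, rotated])
  from fps_expansion_unique_complex[OF this strip_map_has_fps_expansion[OF s0]]
  have "2 * of_nat n * log_coeff f n = complex_of_real (strip_coeff \<delta> n)" for n
    by (simp add: fps_eq_iff)
  hence "(cmod (log_coeff f (Suc n)))\<^sup>2 = w n * (strip_coeff \<delta> (Suc n))\<^sup>2" for n
    unfolding coeff by (simp only: norm_of_real power2_abs)
  hence "(\<lambda>n. (cmod (log_coeff f (Suc n)))\<^sup>2) sums ?B" using B by simp
  thus ?thesis by (intro conjI[OF ballI[OF upper]] bexI[OF _ f(1)])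
qed

end
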